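(* Let $K_1, K_2\in \mathcal{S}^N(k)$ and let $\Omega\in\mathcal{S}^+(n)$. The two equalities $$\hat\beta(\Omega,K_1)=\hat\beta(I,K_2) \quad\text{and}\quad \mathrm{GR}(\Omega,K_1) = \mathrm{GR}(I,K_2)$$ (each understood as holding for all $y\in\mathbb{R}^n$) hold simultaneously if and only if there exists $\Gamma\in\mathcal{S}^+(k)$ such that the following three conditions hold: $$\Omega = X \Gamma X^\top + Z (Z^\top Z)^{-1} Z^\top,$$ $$X^\top X\,\Gamma K_1 = K_2,$$ $$X^\top B X \{ A - (X^\top X)^{-1} \} X^\top B X = 0,$$ where $A = (X^\top X)^{-1} \Gamma^{-1} (X^\top X)^{-1}$ and $B = I - X(X^\top X + K_2)^{-1} X^\top$.
   Context: All matrices are real. $\mathcal{S}^+(m)$ and $\mathcal{S}^N(m)$ denote the sets of $m\times m$ symmetric positive definite and symmetric positive semidefinite matrices, respectively; $I$ is an identity matrix of appropriate size. $X$ is a fixed $n\times k$ matrix with $n>k$ and $\mathrm{rank}(X)=k$. $Z$ is a fixed $n\times(n-k)$ matrix with $X^\top Z=0$ and $\mathrm{rank}(Z)=n-k$. For $\Psi\in\mathcal{S}^+(n)$, $K\in\mathcal{S}^N(k)$ and $y\in\mathbb{R}^n$, the general ridge estimator is $$\hat\beta(\Psi,K) = (X^\top \Psi^{-1}X + K)^{-1} X^\top \Psi^{-1}y ,$$ and the generalized residual sum of squares is $$\mathrm{GR}(\Psi,K) = (y-X \hat\beta(\Psi,K))^\top \Psi^{-1} (y-X \hat\beta(\Psi,K))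 .$$ Equalities between such quantities mean equality for every $y\in\mathbb{R}^n$. *)

theory Defs
  imports "HOL-Analysis.Analysis"
begin

definition posdef :: "real^'m^'m \<Rightarrow> bool" where
  "posdef M \<longleftrightarrow> transpose M = M \<and> (\<forall>v. v \<noteq> 0 \<longrightarrow> v \<bullet> (M *v v) > 0)"

definition possemidef :: "real^'m^'m \<Rightarrow> bool" where
  "possemidef M \<longleftrightarrow> transpose M = M \<and> (\<forall>v. v \<bullet> (M *v v) \<ge> 0)"

(* An n x k matrix has type real^'k^'n (the column index comes first).
   matrix_inv is unspecified on singular matrices; below it is applied to Psi and
   X' Psi^(-1) X + K, which are invertible when Psi is positive definite,
   K is positive semidefinite and X has full column rank. *)
definition gen_ridge ::
  "real^'k^'n \<Rightarrow> real^'n^'n \<Rightarrow> real^'k^'k \<Rightarrow> real^'n \<Rightarrow> real^'k" where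
  "gen_ridge X \<Psi> K y =
     (matrix_inv (transpose X ** matrix_inv \<Psi> ** X + K) ** transpose X ** matrix_inv \<Psi>) *v y"

definition gen_rss ::
  "real^'k^'n \<Rightarrow> real^'n^'n \<Rightarrow> real^'k^'k \<Rightarrow> real^'n \<Rightarrow> real" where
  "gen_rss X \<Psi> K y =
     (y - X *v gen_ridge X \<Psi> K y) \<bullet> (matrix_inv \<Psi> *v (y - X *v gen_ridge X \<Psi> K y))"

end

theory Submission
  imports Defs
begin

text \<open>
  Write \<open>S = X\<^sup>T X\<close>, \<open>W = \<Omega>\<^sup>-\<^sup>1\<close> and \<open>B\<close> for the residual matrix of the ridge estimator
  with weight \<open>I\<close> and penalty \<open>K\<^sub>2\<close>. The column spaces of \<open>X\<close> and \<open>Z\<close> are orthogonal complements,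
  so a matrix is determined by its products with \<open>X\<close> and with \<open>Z\<close>. The required form of \<open>\<Omega>\<close> therefore
  says no more than \<open>\<Omega> X = X \<Gamma> S\<close> and \<open>\<Omega> Z = Z\<close> (\<open>covariance_decomposition_iff\<close>), and it gives
  \<open>X\<^sup>T W = \<Gamma>\<^sup>-\<^sup>1 S\<^sup>-\<^sup>1 X\<^sup>T\<close>, \<open>X\<^sup>T W X = \<Gamma>\<^sup>-\<^sup>1\<close> and \<open>W Z = Z\<close>.

  For such \<open>\<Omega>\<close> the remaining two conditions match the two equalities. The factor \<open>X\<^sup>T\<close> cancels from
  the equality of the estimators, which becomes the \<open>k \<times> k\<close> equation
  \<open>\<Gamma>\<^sup>-\<^sup>1 S\<^sup>-\<^sup>1 (S + K\<^sub>2) = \<Gamma>\<^sup>-\<^sup>1 + K\<^sub>1\<close>, that is \<open>S \<Gamma> K\<^sub>1 = K\<^sub>2\<close> (\<open>gen_ridge_eq_iff\<close>). Once the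
  estimators agree, both residual vectors are \<open>B y\<close>, and the residual sums of squares agree iff the
  symmetric matrix \<open>B\<^sup>T (W - I) B\<close> vanishes. It annihilates \<open>Z\<close>, so only its compression
  \<open>X\<^sup>T B\<^sup>T (W - I) B X\<close> matters, and this is the left-hand side of the third condition
  (\<open>weighted_residual_eq_iff\<close>).

  Conversely, the two equalities force the form of \<open>\<Omega>\<close>
  (\<open>covariance_action_of_equalities\<close>). Equal estimators give \<open>X\<^sup>T W = C X\<^sup>T\<close> with \<open>C\<close> invertible,
  so \<open>\<Omega>\<close> maps the column space of \<open>X\<close> to itself. Equal residual sums of squares, compared on the
  columns of \<open>Z\<close>, give \<open>Z\<^sup>T W Z = Z\<^sup>T Z\<close>. Together with \<open>X\<^sup>T W Z = C X\<^sup>T Z = 0\<close> this yields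
  \<open>W Z = Z\<close>. The matrix \<open>\<Gamma> = S\<^sup>-\<^sup>1 X\<^sup>T \<Omega> X S\<^sup>-\<^sup>1\<close> is then the one sought.
\<close>

section \<open>Matrix algebra\<close>

lemma matrix_vector_adjoint: "(A *v x) \<bullet> y = x \<bullet> (transpose A *v y)"
  for A :: "real^'m^'n"
  by (metis dot_lmul_matrix vector_transpose_matrix transpose_transpose)

lemma transpose_0: "transpose 0 = 0"
  by (simp add: transpose_def vec_eq_iff)

lemma transpose_add: "transpose (A + B) = transpose A + transpose B"
  by (simp add: transpose_def vec_eq_iff)

lemma transpose_diff: "transpose (A - B) = transpose A - transpose B"
  by (simp add: transpose_def vec_eq_iff)

lemma matrix_diff_ldistrib: "A ** (B - C) = A ** B - A ** C"
  for A :: "'a::ring_1^'m^'n"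
  by (simp add: matrix_matrix_mult_def vec_eq_iff right_diff_distrib sum_subtractf)

lemma matrix_diff_rdistrib: "(B - C) ** A = B ** A - C ** A"
  for A :: "'a::ring_1^'m^'n"
  by (simp add: matrix_matrix_mult_def vec_eq_iff left_diff_distrib sum_subtractf)

lemma matrix_add_rdistrib: "(B + C) ** A = B ** A + C ** A"
  for A :: "'a::ring_1^'m^'n"
  by (simp add: matrix_matrix_mult_def vec_eq_iff distrib_right sum.distrib)

lemmas matrix_expand = matrix_mul_assoc[symmetric] matrix_add_ldistrib matrix_add_rdistrib
  matrix_diff_ldistrib matrix_diff_rdistrib

lemma matrix_inv_inverse:
  fixes A :: "real^'n^'n"
  assumes "invertible A"
  shows matrix_inv_left: "matrix_inv A ** A = mat 1" and matrix_inv_right: "A ** matrix_inv A = mat 1"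
proof -
  have "\<exists>A'. A ** A' = mat 1 \<and> A' ** A = mat 1"
    using assms by (simp add: invertible_def)
  then have "A ** matrix_inv A = mat 1 \<and> matrix_inv A ** A = mat 1"
    unfolding matrix_inv_def by (rule someI_ex)
  then show "matrix_inv A ** A = mat 1" and "A ** matrix_inv A = mat 1" by auto
qed

lemma matrix_inv_mult_cancel:
  fixes A :: "real^'n^'n"
  assumes "invertible A"
  shows "matrix_inv A ** (A ** B) = B" and "A ** (matrix_inv A ** B) = B"
  by (simp_all add: matrix_mul_assoc matrix_inv_left matrix_inv_right assms)

lemma mult_eq_iff_matrix_inv_left:
  fixes A :: "real^'n^'n"
  assumes "invertible A"
  shows "A ** B = C \<longleftrightarrow> B = matrix_inv A ** C"
  using matrix_inv_mult_cancel[OF assms] by metis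

lemma mult_eq_iff_matrix_inv_right:
  fixes A :: "real^'n^'n"
  assumes "invertible A"
  shows "B ** A = C \<longleftrightarrow> B = C ** matrix_inv A"
  using assms by (metis matrix_inv_left matrix_inv_right matrix_mul_assoc matrix_mul_rid)

lemma matrix_inv_mat_1: "matrix_inv (mat 1 :: real^'n^'n) = mat 1"
  by (metis invertible_def matrix_inv_left matrix_mul_lid matrix_mul_rid)

section \<open>Positive definite matrices\<close>

lemma posdef_invertible:
  fixes M :: "real^'m^'m"
  assumes "posdef M"
  shows "invertible M"
proof -
  have "M *v v = 0 \<Longrightarrow> v = 0" for v
    using assms unfolding posdef_def by (metis inner_zero_right less_irrefl)
  then show ?thesis
    unfolding invertible_left_inverse matrix_left_invertible_ker by blast
qed

lemma posdef_symmetric: "posdef M \<Longrightarrow> transpose M = M"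
  by (simp add: posdef_def)

lemma matrix_inv_symmetric:
  fixes M :: "real^'m^'m"
  assumes "invertible M" "transpose M = M"
  shows "transpose (matrix_inv M) = matrix_inv M"
proof -
  have "M ** transpose (matrix_inv M) = mat 1"
    using assms by (metis matrix_inv_left matrix_transpose_mul transpose_mat)
  then have "matrix_inv M ** (M ** transpose (matrix_inv M)) = matrix_inv M"
    by simp
  then show ?thesis
    by (simp add: matrix_mul_assoc matrix_inv_left assms)
qed

lemma posdef_congruence:
  fixes M :: "real^'n^'n" and T :: "real^'k^'n"
  assumes "posdef M" "inj ((*v) T)"
  shows "posdef (transpose T ** M ** T)"
proof -
  have "v \<bullet> ((transpose T ** M ** T) *v v) > 0" if "v \<noteq> 0" for v
  proof -
    have "T *v v \<noteq> 0"
      using that assms(2) by (metis injD matrix_vector_mult_0_right)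
    then have "(T *v v) \<bullet> (M *v (T *v v)) > 0"
      using assms(1) by (simp add: posdef_def)
    then show ?thesis
      unfolding matrix_vector_adjoint by (simp add: matrix_vector_mul_assoc matrix_mul_assoc
        del: transpose_matrix_vector)
  qed
  then show ?thesis
    using posdef_symmetric[OF assms(1)]
    by (simp add: posdef_def matrix_transpose_mul matrix_mul_assoc)
qed

lemma posdef_matrix_inv:
  fixes M :: "real^'m^'m"
  assumes "posdef M"
  shows "posdef (matrix_inv M)"
proof -
  note inv = posdef_invertible[OF assms]
  have "inj ((*v) (matrix_inv M))"
    by (metis inj_on_inverseI inv matrix_inv_right matrix_vector_mul_assoc matrix_vector_mul_lid)
  from posdef_congruence[OF assms this] show ?thesis
    by (simp add: matrix_inv_symmetric inv posdef_symmetric assms matrix_inv_left)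
qed

lemma posdef_add_possemidef:
  "posdef M \<Longrightarrow> possemidef K \<Longrightarrow> posdef (M + K)"
  by (auto simp: posdef_def possemidef_def transpose_add
      matrix_vector_mult_add_rdistrib inner_add_right intro: add_pos_nonneg)

lemma posdef_mat_1: "posdef (mat 1)"
  by (simp add: posdef_def)

lemma posdef_gram:
  fixes T :: "real^'k^'n"
  assumes "inj ((*v) T)"
  shows "posdef (transpose T ** T)"
  using posdef_congruence[OF posdef_mat_1 assms] by simp

text \<open>Polarization: the quadratic form at \<open>x + y\<close> recovers the bilinear form of a symmetric matrix.\<close>

lemma symmetric_eq_0_iff_form_eq_0:
  fixes D :: "real^'n^'n"
  assumes "transpose D = D"
  shows "D = 0 \<longleftrightarrow> (\<forall>y. y \<bullet> (D *v y) = 0)"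
proof
  assume form: "\<forall>y. y \<bullet> (D *v y) = 0"
  have "x \<bullet> (D *v y) = 0" for x y
  proof -
    have "y \<bullet> (D *v x) = x \<bullet> (D *v y)"
      by (metis assms dot_lmul_matrix inner_commute vector_transpose_matrix)
    moreover have "(x + y) \<bullet> (D *v (x + y)) = 0"
      using form by blast
    ultimately show ?thesis
      using form by (simp add: matrix_vector_right_distrib inner_add_left inner_add_right)
  qed
  then have "D *v y = 0" for y
    by (metis inner_eq_zero_iff)
  then show "D = 0"
    by (simp add: matrix_eq)
qed simp

section \<open>Orthogonal complements and the form of the covariance\<close>

text \<open>The orthogonal complement of the column space of \<open>X\<close> contains the column space of \<open>Z\<close> and has
  the same dimension, so the two coincide. The vector \<open>v\<close> lies in this space and is also
  orthogonal to it.\<close>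

lemma orthogonal_to_both_eq_0:
  fixes X :: "real^'k^'n" and Z :: "real^'m^'n"
  assumes "rank X + rank Z = CARD('n)" and "transpose X ** Z = 0"
    and "transpose X *v v = 0" and "transpose Z *v v = 0"
  shows "v = 0"
proof -
  let ?U = "range ((*v) X)" and ?V = "range ((*v) Z)"
  let ?C = "{w. \<forall>u \<in> ?U. orthogonal u w}"
  have "dim ?C + dim ?U = CARD('n)"
    using dim_subspace_orthogonal_to_vectors[of ?U "UNIV :: (real^'n) set"]
    by (simp add: subspace_UNIV matrix_vector_mul_linear linear_subspace_image dim_UNIV orthogonal_commute)
  moreover have "dim ?U = rank X" "dim ?V = rank Z"
    by (simp_all add: rank_dim_range)
  ultimately have "dim ?V = dim ?C"
    using assms(1) by simp
  moreover have "?V \<subseteq> ?C"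
    using assms(2) by (auto simp: orthogonal_def matrix_vector_adjoint matrix_vector_mul_assoc simp del: transpose_matrix_vector)
  moreover have "subspace ?V" "subspace ?C"
    by (simp_all only: matrix_vector_mul_linear linear_subspace_image subspace_UNIV
        subspace_orthogonal_to_vectors)
  ultimately have "?V = ?C"
    by (intro subspace_dim_equal) auto
  moreover have "v \<in> ?C"
    using assms(3) by (auto simp: orthogonal_def matrix_vector_adjoint simp del: transpose_matrix_vector)
  ultimately obtain b where "v = Z *v b" by blast
  then have "v \<bullet> v = 0"
    using assms(4) by (simp add: matrix_vector_adjoint del: transpose_matrix_vector)
  then show ?thesis by simp
qed

lemma eq_0_if_orthogonal_to_both:
  fixes X :: "real^'k^'n" and Z :: "real^'m^'n" and M :: "real^'p^'n"
  assumes "rank X + rank Z = CARD('n)" and "transpose X ** Z = 0"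
    and "transpose X ** M = 0" and "transpose Z ** M = 0"
  shows "M = 0"
proof -
  have "M *v w = 0" for w
    using orthogonal_to_both_eq_0[OF assms(1,2), of "M *v w"] assms(3,4)
    by (simp add: matrix_vector_mul_assoc del: transpose_matrix_vector)
  then show ?thesis
    by (simp add: matrix_eq)
qed

lemma eq_0_if_annihilates_both:
  fixes X :: "real^'k^'n" and Z :: "real^'m^'n" and M :: "real^'n^'p"
  assumes "rank X + rank Z = CARD('n)" and "transpose X ** Z = 0"
    and "M ** X = 0" and "M ** Z = 0"
  shows "M = 0"
proof -
  have "transpose M = 0"
    using assms(3,4) by (intro eq_0_if_orthogonal_to_both[OF assms(1,2)])
      (metis matrix_transpose_mul transpose_0)+
  then show ?thesis
    by (metis transpose_transpose transpose_0)
qed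

text \<open>Both sides of the decomposition are compared on the columns of \<open>X\<close> and of \<open>Z\<close>. This trades an
  explicit formula for \<open>\<Omega>\<close> for two equations that pass easily to \<open>\<Omega>\<^sup>-\<^sup>1\<close>.\<close>

lemma covariance_decomposition_iff:
  fixes X :: "real^'k^'n" and Z :: "real^'m^'n" and \<Omega> :: "real^'n^'n" and \<Gamma> :: "real^'k^'k"
  assumes "rank X + rank Z = CARD('n)" and XZ: "transpose X ** Z = 0" and "inj ((*v) Z)"
  shows "\<Omega> = X ** \<Gamma> ** transpose X + Z ** matrix_inv (transpose Z ** Z) ** transpose Z
     \<longleftrightarrow> \<Omega> ** X = X ** \<Gamma> ** (transpose X ** X) \<and> \<Omega> ** Z = Z"
    (is "\<Omega> = ?N \<longleftrightarrow> _")
proof -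
  have ZX: "transpose Z ** X = 0"
    using XZ by (metis matrix_transpose_mul transpose_transpose transpose_0)
  have inv: "invertible (transpose Z ** Z)"
    by (simp add: posdef_invertible posdef_gram assms(3))
  have N: "?N ** X = X ** \<Gamma> ** (transpose X ** X)" "?N ** Z = Z"
    by (simp_all add: matrix_expand XZ ZX matrix_inv_left[OF inv])
  have "\<Omega> = ?N" if "\<Omega> ** X = ?N ** X" "\<Omega> ** Z = ?N ** Z"
    using eq_0_if_annihilates_both[OF assms(1,2), of "\<Omega> - ?N"] that
    by (simp add: matrix_diff_rdistrib)
  then show ?thesis
    using N by metis
qed

lemma precision_action:
  fixes X :: "real^'k^'n" and Z :: "real^'m^'n" and \<Omega> :: "real^'n^'n" and \<Gamma> :: "real^'k^'k"
  assumes \<Omega>: "posdef \<Omega>" and \<Gamma>: "posdef \<Gamma>" and X: "inj ((*v) X)"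
    and "\<Omega> ** X = X ** \<Gamma> ** (transpose X ** X)" and "\<Omega> ** Z = Z"
  shows "matrix_inv \<Omega> ** X = X ** matrix_inv (transpose X ** X) ** matrix_inv \<Gamma>"
    and "transpose X ** matrix_inv \<Omega> = matrix_inv \<Gamma> ** matrix_inv (transpose X ** X) ** transpose X"
    and "matrix_inv \<Omega> ** Z = Z"
proof -
  note S = posdef_gram[OF X]
  note inv = posdef_invertible[OF \<Omega>] posdef_invertible[OF \<Gamma>] posdef_invertible[OF S]
  have "X = matrix_inv \<Omega> ** X ** \<Gamma> ** (transpose X ** X)"
    using assms(4) by (simp add: mult_eq_iff_matrix_inv_left inv matrix_mul_assoc)
  then show 1: "matrix_inv \<Omega> ** X = X ** matrix_inv (transpose X ** X) ** matrix_inv \<Gamma>"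
    by (metis mult_eq_iff_matrix_inv_right inv(2,3))
  show "transpose X ** matrix_inv \<Omega> = matrix_inv \<Gamma> ** matrix_inv (transpose X ** X) ** transpose X"
    using arg_cong[OF 1, of transpose]
    by (simp add: matrix_transpose_mul matrix_inv_symmetric inv posdef_symmetric \<Omega> \<Gamma> matrix_mul_assoc)
  show "matrix_inv \<Omega> ** Z = Z"
    using assms(5) mult_eq_iff_matrix_inv_left[OF inv(1)] by metis
qed

section \<open>Equality of the estimators and of the residual sums of squares\<close>

lemma gen_ridge_eq_iff_matrix_eq:
  "(\<forall>y. gen_ridge X \<Omega> K1 y = gen_ridge X (mat 1) K2 y) \<longleftrightarrow>
   matrix_inv (transpose X ** matrix_inv \<Omega> ** X + K1) ** transpose X ** matrix_inv \<Omega> =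
   matrix_inv (transpose X ** X + K2) ** transpose X"
  by (simp add: gen_ridge_def matrix_eq matrix_inv_mat_1)

lemma gen_rss_quadratic_form:
  fixes X :: "real^'k^'n" and G :: "real^'n^'k"
  assumes "gen_ridge X \<Psi> K y = G *v y"
  shows "gen_rss X \<Psi> K y =
    y \<bullet> ((transpose (mat 1 - X ** G) ** matrix_inv \<Psi> ** (mat 1 - X ** G)) *v y)"
proof -
  have "y - X *v gen_ridge X \<Psi> K y = (mat 1 - X ** G) *v y"
    by (simp add: assms matrix_vector_mul_assoc matrix_vector_mult_diff_rdistrib)
  then show ?thesis
    unfolding gen_rss_def
    by (simp add: matrix_vector_adjoint matrix_vector_mul_assoc matrix_mul_assoc
        del: transpose_matrix_vector)
qed

text \<open>With equal estimators, both residuals are \<open>B y\<close>, and the difference of the residual sums of squares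
  is the quadratic form of a symmetric matrix in \<open>y\<close>.\<close>

lemma gen_rss_eq_iff_matrix_eq:
  fixes X :: "real^'k^'n"
  defines "B K \<equiv> mat 1 - X ** matrix_inv (transpose X ** X + K) ** transpose X"
  assumes \<Omega>: "posdef \<Omega>" and ridge: "\<forall>y. gen_ridge X \<Omega> K1 y = gen_ridge X (mat 1) K2 y"
  shows "(\<forall>y. gen_rss X \<Omega> K1 y = gen_rss X (mat 1) K2 y) \<longleftrightarrow>
    transpose (B K2) ** matrix_inv \<Omega> ** B K2 = transpose (B K2) ** B K2"
proof -
  let ?B = "B K2"
  let ?D = "transpose ?B ** matrix_inv \<Omega> ** ?B - transpose ?B ** ?B"
  define G where "G = matrix_inv (transpose X ** X + K2) ** transpose X"
  have G: "gen_ridge X (mat 1) K2 y = G *v y" for y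
    by (simp add: gen_ridge_def G_def matrix_inv_mat_1)
  have B: "?B = mat 1 - X ** G"
    by (simp add: B_def G_def matrix_mul_assoc)
  have "gen_rss X \<Omega> K1 y - gen_rss X (mat 1) K2 y = y \<bullet> (?D *v y)" for y
    using gen_rss_quadratic_form[of X \<Omega> K1 y G] gen_rss_quadratic_form[of X "mat 1" K2 y G]
    by (simp add: ridge G B matrix_inv_mat_1 matrix_vector_mult_diff_rdistrib inner_diff_right)
  moreover have "transpose ?D = ?D"
    by (simp add: transpose_diff matrix_transpose_mul matrix_mul_assoc
        matrix_inv_symmetric posdef_invertible posdef_symmetric \<Omega>)
  ultimately show ?thesis
    using symmetric_eq_0_iff_form_eq_0[of ?D] by (metis eq_iff_diff_eq_0)
qed

text \<open>Since \<open>X\<^sup>T \<Omega>\<^sup>-\<^sup>1 = \<Gamma>\<^sup>-\<^sup>1 S\<^sup>-\<^sup>1 X\<^sup>T\<close> for \<open>S = X\<^sup>T X\<close>, both estimators are a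
  \<open>k \<times> k\<close> matrix applied to \<open>X\<^sup>T y\<close>, and \<open>X\<^sup>T\<close> has a right inverse.\<close>

lemma gen_ridge_eq_iff:
  fixes X :: "real^'k^'n" and Z :: "real^'m^'n" and \<Omega> :: "real^'n^'n" and \<Gamma> :: "real^'k^'k"
  assumes \<Omega>: "posdef \<Omega>" and \<Gamma>: "posdef \<Gamma>" and X: "inj ((*v) X)"
    and K: "possemidef K1" "possemidef K2"
    and \<Omega>X: "\<Omega> ** X = X ** \<Gamma> ** (transpose X ** X)"
  shows "(\<forall>y. gen_ridge X \<Omega> K1 y = gen_ridge X (mat 1) K2 y) \<longleftrightarrow>
    transpose X ** X ** \<Gamma> ** K1 = K2"
proof -
  let ?S = "transpose X ** X"
  let ?M1 = "matrix_inv \<Gamma> + K1" and ?M2 = "?S + K2"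
  note S = posdef_gram[OF X]
  note inv = posdef_invertible[OF \<Omega>] posdef_invertible[OF \<Gamma>] posdef_invertible[OF S]
    posdef_invertible[OF posdef_add_possemidef[OF posdef_matrix_inv[OF \<Gamma>] K(1)]]
    posdef_invertible[OF posdef_add_possemidef[OF S K(2)]]
  \<comment> \<open>This identity only involves the columns of \<open>X\<close>, so the zero matrix can stand for \<open>Z\<close>.\<close>
  have XW: "transpose X ** matrix_inv \<Omega> = matrix_inv \<Gamma> ** matrix_inv ?S ** transpose X"
    using precision_action(2)[OF \<Omega> \<Gamma> X \<Omega>X, of 0] by simp
  have XWX: "transpose X ** matrix_inv \<Omega> ** X = matrix_inv \<Gamma>"
    unfolding XW by (simp add: matrix_expand matrix_inv_left[OF inv(3)])
  have cancel_X: "P ** transpose X = Q ** transpose X \<longleftrightarrow> P = Q" for P Q :: "real^'k^'k"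
    by (metis inv(3) matrix_mul_assoc mult_eq_iff_matrix_inv_right)
  have inv_quotient: "matrix_inv P ** N = matrix_inv Q \<longleftrightarrow> N ** Q = P"
    if "invertible P" "invertible Q" for P Q N :: "real^'k^'k"
    using mult_eq_iff_matrix_inv_left[OF that(1), of "matrix_inv Q" N]
      mult_eq_iff_matrix_inv_right[OF that(2), of N P] by auto
  have solve: "matrix_inv P ** (matrix_inv Q ** N) = R \<longleftrightarrow> Q ** P ** R = N"
    if "invertible P" "invertible Q" for P Q N R :: "real^'k^'k"
    using mult_eq_iff_matrix_inv_left[OF that(2), of "P ** R" N]
      mult_eq_iff_matrix_inv_left[OF that(1), of R "matrix_inv Q ** N"]
    by (auto simp: matrix_mul_assoc)
  have "(\<forall>y. gen_ridge X \<Omega> K1 y = gen_ridge X (mat 1) K2 y) \<longleftrightarrow>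
    matrix_inv ?M1 ** (matrix_inv \<Gamma> ** matrix_inv ?S) ** transpose X = matrix_inv ?M2 ** transpose X"
    unfolding gen_ridge_eq_iff_matrix_eq XWX by (simp add: XW flip: matrix_mul_assoc)
  also have "\<dots> \<longleftrightarrow> matrix_inv ?M1 ** (matrix_inv \<Gamma> ** matrix_inv ?S) = matrix_inv ?M2"
    by (rule cancel_X)
  also have "\<dots> \<longleftrightarrow> matrix_inv \<Gamma> ** matrix_inv ?S ** ?M2 = ?M1"
    by (rule inv_quotient[OF inv(4,5)])
  also have "\<dots> \<longleftrightarrow> matrix_inv \<Gamma> ** (matrix_inv ?S ** K2) = K1"
    by (simp add: matrix_add_ldistrib matrix_inv_left[OF inv(3)] flip: matrix_mul_assoc)
  also have "\<dots> \<longleftrightarrow> ?S ** \<Gamma> ** K1 = K2"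
    by (rule solve[OF inv(2,3)])
  finally show ?thesis .
qed

text \<open>The matrix \<open>D = B\<^sup>T (\<Omega>\<^sup>-\<^sup>1 - I) B\<close> is symmetric and kills \<open>Z\<close>, because \<open>B\<close> and \<open>\<Omega>\<^sup>-\<^sup>1\<close> fix \<open>Z\<close>.
  Hence it vanishes as soon as \<open>X\<^sup>T D X\<close> does. As \<open>B X = X F\<close> for a square \<open>F\<close>, writing
  \<open>S = X\<^sup>T X\<close> gives \<open>X\<^sup>T D X = F\<^sup>T (\<Gamma>\<^sup>-\<^sup>1 - S) F\<close>, and
  \<open>\<Gamma>\<^sup>-\<^sup>1 - S = S (A - S\<^sup>-\<^sup>1) S\<close> turns this into the stated product, since
  \<open>F\<^sup>T S = S F = X\<^sup>T B X\<close>.\<close>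

lemma weighted_residual_eq_iff:
  fixes X :: "real^'k^'n" and Z :: "real^'m^'n" and \<Omega> :: "real^'n^'n" and \<Gamma> :: "real^'k^'k"
  defines "A \<equiv> matrix_inv (transpose X ** X) ** matrix_inv \<Gamma> ** matrix_inv (transpose X ** X)"
    and "B K \<equiv> mat 1 - X ** matrix_inv (transpose X ** X + K) ** transpose X"
  assumes rank: "rank X + rank Z = CARD('n)" and XZ: "transpose X ** Z = 0"
    and \<Omega>: "posdef \<Omega>" and \<Gamma>: "posdef \<Gamma>" and X: "inj ((*v) X)"
    and K: "possemidef K"
    and \<Omega>X: "\<Omega> ** X = X ** \<Gamma> ** (transpose X ** X)" and \<Omega>Z: "\<Omega> ** Z = Z"
  shows "transpose (B K) ** matrix_inv \<Omega> ** B K = transpose (B K) ** B K \<longleftrightarrow>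
    transpose X ** B K ** X ** (A - matrix_inv (transpose X ** X)) ** transpose X ** B K ** X = 0"
proof -
  let ?S = "transpose X ** X" and ?B = "B K" and ?W = "matrix_inv \<Omega>"
  let ?M = "?S + K"
  let ?D = "transpose ?B ** ?W ** ?B - transpose ?B ** ?B"
  note S = posdef_gram[OF X] and M = posdef_add_possemidef[OF posdef_gram[OF X] K]
  note inv = posdef_invertible[OF S] posdef_invertible[OF M]
  note W = precision_action[OF \<Omega> \<Gamma> X \<Omega>X \<Omega>Z]
  have B_sym: "transpose ?B = ?B"
    by (simp add: B_def transpose_diff matrix_transpose_mul matrix_inv_symmetric
        inv(2) posdef_symmetric[OF M] matrix_mul_assoc)
  have BZ: "?B ** Z = Z"
    by (simp add: B_def matrix_expand XZ)
  have D_sym: "transpose ?D = ?D"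
    by (simp add: transpose_diff matrix_transpose_mul matrix_mul_assoc
        matrix_inv_symmetric posdef_invertible posdef_symmetric \<Omega>)
  have DZ: "?D ** Z = 0"
    by (simp add: matrix_expand BZ W(3) B_sym)
  have "?D = 0" if "transpose X ** ?D ** X = 0"
  proof -
    have "transpose X ** ?D = 0"
      using DZ by (intro eq_0_if_annihilates_both[OF rank XZ that]) (simp flip: matrix_mul_assoc)
    then have "?D ** X = 0"
      using D_sym by (metis matrix_transpose_mul transpose_transpose transpose_0)
    then show ?thesis
      using eq_0_if_annihilates_both[OF rank XZ _ DZ] by simp
  qed
  then have D_iff: "?D = 0 \<longleftrightarrow> transpose X ** ?D ** X = 0"
    by (metis times0_left times0_right)
  define F where "F = mat 1 - matrix_inv ?M ** ?S"
  have BX: "?B ** X = X ** F"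
    by (simp add: B_def F_def matrix_expand)
  then have XB: "transpose X ** ?B = transpose F ** transpose X"
    using B_sym by (metis matrix_transpose_mul)
  have XBX: "transpose X ** ?B ** X = ?S ** F" "transpose X ** ?B ** X = transpose F ** ?S"
    using BX XB by (metis matrix_mul_assoc)+
  have "transpose X ** ?D ** X = (transpose X ** ?B) ** (?W ** (?B ** X)) - (transpose X ** ?B) ** (?B ** X)"
    by (simp add: B_sym matrix_expand)
  also have "\<dots> = transpose F ** (transpose X ** (?W ** X) - ?S) ** F"
    unfolding BX XB by (simp add: matrix_expand)
  also have "transpose X ** (?W ** X) = matrix_inv \<Gamma>"
    unfolding W(1) by (simp add: matrix_mul_assoc matrix_inv_right[OF inv(1)])
  also have "matrix_inv \<Gamma> - ?S = ?S ** (A - matrix_inv ?S) ** ?S"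
  proof -
    have "N - Q = Q ** (matrix_inv Q ** N ** matrix_inv Q - matrix_inv Q) ** Q"
      if "invertible Q" for N Q :: "real^'k^'k"
      by (simp add: matrix_expand matrix_inv_left matrix_inv_mult_cancel that)
    then show ?thesis
      unfolding A_def using inv(1) by blast
  qed
  also have "transpose F ** \<dots> ** F =
      (transpose F ** ?S) ** (A - matrix_inv ?S) ** (?S ** F)"
    by (simp only: matrix_mul_assoc)
  also have "\<dots> = transpose X ** ?B ** X ** (A - matrix_inv ?S) ** transpose X ** ?B ** X"
    unfolding XBX(1)[symmetric] XBX(2)[symmetric] by (simp only: matrix_mul_assoc)
  finally show ?thesis
    using D_iff by simp
qed

section \<open>The covariance forced by the two equalities\<close>

text \<open>Multiplying \<open>\<Omega> X = X \<Gamma> S\<close> by \<open>S\<^sup>-\<^sup>1 X\<^sup>T\<close> from the left and by \<open>S\<^sup>-\<^sup>1\<close> from the right shows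
  that \<open>\<Gamma>\<close> can only be the matrix defined here. As a congruence transform of \<open>\<Omega>\<close> it is positive
  definite. Equality of the estimators gives the action of \<open>\<Omega>\<close> on \<open>X\<close>. For the action on \<open>Z\<close>, the
  residual sums of squares are needed as well.\<close>

lemma covariance_action_of_equalities:
  fixes X :: "real^'k^'n" and Z :: "real^'m^'n" and \<Omega> :: "real^'n^'n"
  defines "S \<equiv> transpose X ** X"
  defines "\<Gamma> \<equiv> matrix_inv S ** (transpose X ** \<Omega> ** X) ** matrix_inv S"
  assumes rank: "rank X + rank Z = CARD('n)" and XZ: "transpose X ** Z = 0"
    and \<Omega>: "posdef \<Omega>" and X: "inj ((*v) X)"
    and K: "possemidef K1" "possemidef K2"
    and ridge: "\<forall>y. gen_ridge X \<Omega> K1 y = gen_ridge X (mat 1) K2 y"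
    and rss: "\<forall>y. gen_rss X \<Omega> K1 y = gen_rss X (mat 1) K2 y"
  shows "posdef \<Gamma>" and "\<Omega> ** X = X ** \<Gamma> ** (transpose X ** X)" and "\<Omega> ** Z = Z"
proof -
  let ?W = "matrix_inv \<Omega>"
  let ?M2 = "S + K2"
  define M1 where "M1 = transpose X ** ?W ** X + K1"
  have S: "posdef S"
    unfolding S_def by (rule posdef_gram[OF X])
  note inv = posdef_invertible[OF \<Omega>] posdef_invertible[OF S]
    posdef_invertible[OF posdef_add_possemidef[OF posdef_congruence[OF posdef_matrix_inv[OF \<Omega>] X] K(1)], folded M1_def]
    posdef_invertible[OF posdef_add_possemidef[OF S K(2)]]
  have inv_sym: "transpose (matrix_inv S) = matrix_inv S"
    by (simp add: matrix_inv_symmetric inv posdef_symmetric S)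
  have "inj ((*v) (matrix_inv S))"
    by (metis inj_on_inverseI inv(2) matrix_inv_right matrix_vector_mul_assoc matrix_vector_mul_lid)
  from posdef_congruence[OF posdef_congruence[OF \<Omega> X] this]
  show "posdef \<Gamma>"
    by (simp add: \<Gamma>_def inv_sym)
  have "matrix_inv M1 ** (transpose X ** ?W) = matrix_inv ?M2 ** transpose X"
    using ridge unfolding gen_ridge_eq_iff_matrix_eq by (simp add: S_def M1_def matrix_mul_assoc)
  then have XW: "transpose X ** ?W = M1 ** (matrix_inv ?M2 ** transpose X)"
    by (metis inv(3) matrix_inv_mult_cancel(2))
  \<comment> \<open>The inverse of the matrix \<open>C\<close> in \<open>X\<^sup>T \<Omega>\<^sup>-\<^sup>1 = C X\<^sup>T\<close>.\<close>
  define T where "T = ?M2 ** matrix_inv M1"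
  have "T ** (transpose X ** ?W) = transpose X"
    unfolding XW T_def by (simp add: matrix_inv_mult_cancel inv flip: matrix_mul_assoc)
  then have "transpose X ** \<Omega> = T ** transpose X"
    by (metis inv(1) matrix_inv_left matrix_mul_assoc matrix_mul_rid)
  then have \<Omega>X: "\<Omega> ** X = X ** transpose T"
    using posdef_symmetric[OF \<Omega>] by (metis matrix_transpose_mul transpose_transpose)
  have "X ** \<Gamma> ** (transpose X ** X) = X ** (matrix_inv S ** (transpose X ** (\<Omega> ** X)))"
    unfolding \<Gamma>_def S_def[symmetric] by (simp add: matrix_inv_left inv flip: matrix_mul_assoc)
  also have "\<dots> = X ** transpose T"
    unfolding \<Omega>X by (metis S_def inv(2) matrix_inv_mult_cancel(1) matrix_mul_assoc)
  finally show "\<Omega> ** X = X ** \<Gamma> ** (transpose X ** X)"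
    using \<Omega>X by simp
  define B where "B = mat 1 - X ** matrix_inv ?M2 ** transpose X"
  have BWB: "transpose B ** ?W ** B = transpose B ** B"
    using rss gen_rss_eq_iff_matrix_eq[OF \<Omega> ridge] by (simp add: B_def S_def)
  \<comment> \<open>\<open>B\<close> fixes \<open>Z\<close>, so compressing \<open>BWB\<close> to the columns of \<open>Z\<close> removes \<open>B\<close> from both sides.\<close>
  have BZ: "B ** Z = Z"
    by (simp add: B_def matrix_expand XZ)
  then have ZB: "transpose Z ** transpose B = transpose Z"
    by (metis matrix_transpose_mul)
  have "transpose Z ** (?W ** Z) = transpose Z ** (transpose B ** ?W ** B) ** Z"
    by (simp add: matrix_mul_assoc ZB) (simp add: BZ flip: matrix_mul_assoc)
  also have "\<dots> = transpose Z ** Z"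
    unfolding BWB by (simp add: matrix_mul_assoc ZB) (simp add: BZ flip: matrix_mul_assoc)
  finally have "transpose Z ** (?W ** Z - Z) = 0"
    by (simp add: matrix_diff_ldistrib)
  moreover have "transpose X ** (?W ** Z - Z) = 0"
    by (simp add: matrix_diff_ldistrib XZ matrix_mul_assoc XW) (simp add: XZ flip: matrix_mul_assoc)
  ultimately have "?W ** Z - Z = 0"
    by (intro eq_0_if_orthogonal_to_both[OF rank XZ])
  then show "\<Omega> ** Z = Z"
    using mult_eq_iff_matrix_inv_left[OF inv(1), of Z Z] by simp
qed

section \<open>The characterization\<close>

theorem theorem4:
  fixes X :: "real^'k^'n" and Z :: "real^'m^'n"
    and K1 K2 :: "real^'k^'k" and \<Omega> :: "real^'n^'n"
  assumes "CARD('n) > CARD('k)"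
    and "CARD('m) = CARD('n) - CARD('k)"
    and "rank X = CARD('k)"
    and "transpose X ** Z = 0"
    and "rank Z = CARD('n) - CARD('k)"
    and "possemidef K1" and "possemidef K2"
    and "posdef \<Omega>"
  shows "((\<forall>y. gen_ridge X \<Omega> K1 y = gen_ridge X (mat 1) K2 y) \<and>
          (\<forall>y. gen_rss X \<Omega> K1 y = gen_rss X (mat 1) K2 y))
     \<longleftrightarrow>
     (\<exists>\<Gamma> :: real^'k^'k. posdef \<Gamma> \<and>
        (let A = matrix_inv (transpose X ** X) ** matrix_inv \<Gamma> ** matrix_inv (transpose X ** X);
             B = mat 1 - X ** matrix_inv (transpose X ** X + K2) ** transpose X
         in \<Omega> = X ** \<Gamma> ** transpose X + Z ** matrix_inv (transpose Z ** Z) ** transpose Z \<and>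
            transpose X ** X ** \<Gamma> ** K1 = K2 \<and>
            transpose X ** B ** X ** (A - matrix_inv (transpose X ** X)) ** transpose X ** B ** X = 0))"
proof -
  have X: "inj ((*v) X)" and Z: "inj ((*v) Z)"
    using assms(2,3,5) by (simp_all flip: full_rank_injective)
  have rank: "rank X + rank Z = CARD('n)"
    using assms(1,3,5) by simp
  note decomposition = covariance_decomposition_iff[OF rank assms(4) Z]
  have given_\<Gamma>: "(\<forall>y. gen_ridge X \<Omega> K1 y = gen_ridge X (mat 1) K2 y) \<and>
      (\<forall>y. gen_rss X \<Omega> K1 y = gen_rss X (mat 1) K2 y) \<longleftrightarrow>
      transpose X ** X ** \<Gamma> ** K1 = K2 \<and>
      (let A = matrix_inv (transpose X ** X) ** matrix_inv \<Gamma> ** matrix_inv (transpose X ** X);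
           B = mat 1 - X ** matrix_inv (transpose X ** X + K2) ** transpose X
       in transpose X ** B ** X ** (A - matrix_inv (transpose X ** X)) ** transpose X ** B ** X = 0)"
    if "posdef \<Gamma>" "\<Omega> ** X = X ** \<Gamma> ** (transpose X ** X)" "\<Omega> ** Z = Z" for \<Gamma>
    using gen_ridge_eq_iff[OF assms(8) that(1) X assms(6,7) that(2)]
      gen_rss_eq_iff_matrix_eq[OF assms(8)]
      weighted_residual_eq_iff[OF rank assms(4,8) that(1) X assms(7) that(2,3)]
    unfolding Let_def by blast
  show ?thesis (is "?equalities \<longleftrightarrow> ?conditions")
  proof
    assume ?equalities
    then show ?conditions
      using covariance_action_of_equalities[OF rank assms(4,8) X assms(6,7)] given_\<Gamma>
      unfolding Let_def decomposition by blast
  next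
    assume ?conditions
    then show ?equalities
      using given_\<Gamma> unfolding Let_def decomposition by blast
  qed
qed

end
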